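(* Let $a<b$ be real numbers. Let $\nu:[a,b]\to[0,\infty)$ be continuous and positive, let $w:[a,b]\to\mathbb{R}$ be differentiable with $w'(t)=\nu(t)$ on $[a,b]$, let $f:[a,b]\to\mathbb{R}$ be twice differentiable, and let $\psi:[0,1]\to[0,1]$ be a function. For $\lambda\in[0,1]$ and $s,t\in[a,b]$ put $$\Phi(\lambda)=\frac{1+\psi(1-\lambda)-\psi(\lambda)}{2},\qquad K(s,t)=\begin{cases} w(s)-\left(w(a)+\psi(\lambda)\frac{w(b)-w(a)}{2}\right), & s\in[a,t),\\ w(s)-\left(w(a)+(1+\psi(1-\lambda))\frac{w(b)-w(a)}{2}\right), & s\in[t,b],\end{cases}$$ and assume $M=\sup_{a<t<b}|f''(t)|<\infty$. Then for all $x\in[a,b]$ and all $\lambda\in[0,1]$, $$\begin{aligned} &\Bigg|\Phi^2(\lambda)f(x)-\frac{1}{\left(\int_a^b\nu(t)dt\right)^2}\left(\int_a^bK(t,x)dt\right)\left(\int_a^b\nu(s)f'(s)ds\right)\\ &\quad+\frac{\psi(\lambda)f'(a)+(1-\psi(1-\lambda))f'(b)}{2\int_a^b\nu(t)dt}\int_a^bK(t,x)dt\\ &\quad-\frac{\Phi(\lambda)}{\int_a^b\nu(t)dt}\int_a^b\nu(t)f(t)dt+\frac{\psi(\lambda)f(a)+(1-\psi(1-\lambda))f(b)}{2}\Phi(\lambda)\Bigg|\\ &\le\frac{M}{\left(\int_a^b\nu(t)dt\right)^2}\int_a^b\int_a^b|K(t,x)|\,|K(s,t)|\,ds\,dt.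 \end{aligned}$$
   Context: Here $[a,b]$ is the usual real interval; derivatives at the endpoints $a,b$ are one-sided. *)

theory Defs
  imports "HOL-Analysis.Analysis"
begin

definition Phi :: "(real \<Rightarrow> real) \<Rightarrow> real \<Rightarrow> real" where
  "Phi \<psi> l = (1 + \<psi> (1 - l) - \<psi> l) / 2"

(* Only used for s, t in {a..b}: the first branch is then s in [a, t), the second s in [t, b]. *)
definition weighted_kernel ::
  "real \<Rightarrow> real \<Rightarrow> (real \<Rightarrow> real) \<Rightarrow> (real \<Rightarrow> real) \<Rightarrow> real \<Rightarrow> real \<Rightarrow> real \<Rightarrow> real" where
  "weighted_kernel a b w \<psi> l s t =
     (if s < t then w s - (w a + \<psi> l * ((w b - w a) / 2))
      else w s - (w a + (1 + \<psi> (1 - l)) * ((w b - w a) / 2)))"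

end

theory Submission
  imports Defs
begin

text \<open>Integration by parts on both sides of the jump of the kernel \<open>K\<close> yields a weighted
  Montgomery identity, which expresses \<open>\<Phi>(\<lambda>) g(t)\<close> through the endpoint values of \<open>g\<close>, the
  weighted mean of \<open>g\<close> and \<open>\<integral> K(s,t) g'(s) ds\<close>.  Applying it to \<open>f\<close> at \<open>x\<close>, and then to \<open>f'\<close>
  at \<open>t\<close> inside \<open>\<integral> K(t,x) f'(t) dt\<close>, turns the left-hand side into the iterated integral of
  \<open>K(t,x) K(s,t) f''(s)\<close>, divided by the square of \<open>\<integral> \<nu>\<close>.\<close>

text \<open>On \<open>{a..t}\<close> the integrand differs from \<open>p\<close> only at the single
  point \<open>t\<close>, a negligible set, so the two pieces can be joined at the jump.\<close>

lemma has_integral_if_less: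
  fixes p q :: "real \<Rightarrow> real"
  assumes "a \<le> t" "t \<le> b" "(p has_integral I) {a..t}" "(q has_integral J) {t..b}"
  shows "((\<lambda>s. if s < t then p s else q s) has_integral I + J) {a..b}"
proof (rule has_integral_combine[OF assms(1,2)])
  show "((\<lambda>s. if s < t then p s else q s) has_integral I) {a..t}"
    by (rule has_integral_spike[OF negligible_sing[of t] _ assms(3)]) auto
  show "((\<lambda>s. if s < t then p s else q s) has_integral J) {t..b}"
    by (rule has_integral_eq[OF _ assms(4)]) auto
qed

text \<open>Although the jump of the integrand moves with \<open>t\<close>, splitting there leaves
  an indefinite integral of \<open>p\<close> with moving upper limit and one of \<open>q\<close>
  with moving lower limit, both continuous in \<open>t\<close>. This makes the outer integrand of
  the final double integral integrable.\<close>

lemma continuous_on_integral_if_less: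
  fixes p q :: "real \<Rightarrow> real"
  assumes p: "continuous_on {a..b} p" and q: "continuous_on {a..b} q"
  shows "continuous_on {a..b} (\<lambda>t. integral {a..b} (\<lambda>s. if s < t then p s else q s))"
proof -
  have ip: "p integrable_on {a..b}" and iq: "q integrable_on {a..b}"
    using p q by (auto intro: integrable_continuous_real)
  have "integral {a..b} (\<lambda>s. if s < t then p s else q s) = integral {a..t} p + integral {t..b} q"
    if "t \<in> {a..b}" for t
  proof (rule integral_unique, rule has_integral_if_less)
    show "(p has_integral integral {a..t} p) {a..t}"
      using ip that by (intro integrable_integral) (auto intro: integrable_on_subinterval)
    show "(q has_integral integral {t..b} q) {t..b}"
      using iq that by (intro integrable_integral) (auto intro: integrable_on_subinterval)
  qed (use that in auto)
  moreover have "continuous_on {a..b} (\<lambda>t. integral {a..t} p + integral {t..b} q)"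
    by (intro continuous_on_add indefinite_integral_continuous_1 indefinite_integral_continuous_1' ip iq)
  ultimately show ?thesis
    by (auto intro: continuous_on_eq)
qed

lemma integrable_on_if_less:
  fixes p q :: "real \<Rightarrow> real"
  assumes "t \<in> {a..b}" "continuous_on {a..b} p" "continuous_on {a..b} q"
  shows "(\<lambda>s. if s < t then p s else q s) integrable_on {a..b}"
proof -
  have "p integrable_on {a..t}" "q integrable_on {t..b}"
    using assms by (auto intro!: integrable_continuous_real elim: continuous_on_subset)
  then show ?thesis
    using has_integral_if_less[of a t b p _ q] assms(1) unfolding integrable_on_def by auto
qed

text \<open>Every \<open>w - c\<close> is an antiderivative of \<open>\<nu>\<close>, so the constant
  can be chosen separately on each side of the jump of the kernel. As \<open>g'\<close> is just some
  derivative, integrability of the product is part of the claim: the fundamental theorem covers the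
  whole derivative of \<open>(w - c) * g\<close>, from which the continuous \<open>\<nu> * g\<close>
  is subtracted.\<close>

lemma has_integral_by_parts_shift:
  fixes w \<nu> g g' :: "real \<Rightarrow> real"
  assumes "a \<le> b" "continuous_on {a..b} \<nu>"
    and w: "\<And>t. t \<in> {a..b} \<Longrightarrow> (w has_real_derivative \<nu> t) (at t within {a..b})"
    and g: "\<And>t. t \<in> {a..b} \<Longrightarrow> (g has_real_derivative g' t) (at t within {a..b})"
  shows "((\<lambda>s. (w s - c) * g' s) has_integral
    (w b - c) * g b - (w a - c) * g a - integral {a..b} (\<lambda>s. \<nu> s * g s)) {a..b}"
proof -
  have ftc: "((\<lambda>s. (w s - c) * g' s + \<nu> s * g s) has_integral (w b - c) * g b - (w a - c) * g a) {a..b}"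
    by (rule fundamental_theorem_of_calculus[OF assms(1)])
      (auto simp flip: has_real_derivative_iff_has_vector_derivative
        intro!: derivative_eq_intros w g)
  have "continuous_on {a..b} g"
    using g DERIV_continuous_on by blast
  then have int: "(\<lambda>s. \<nu> s * g s) integrable_on {a..b}"
    using assms(2) by (intro integrable_continuous_real continuous_intros)
  show ?thesis
    using has_integral_diff[OF ftc integrable_integral[OF int]] by simp
qed

lemma weighted_montgomery_identity:
  fixes w \<nu> g g' :: "real \<Rightarrow> real"
  assumes t: "t \<in> {a..b}" and \<nu>: "continuous_on {a..b} \<nu>"
    and w: "\<And>t. t \<in> {a..b} \<Longrightarrow> (w has_real_derivative \<nu> t) (at t within {a..b})"
    and g: "\<And>t. t \<in> {a..b} \<Longrightarrow> (g has_real_derivative g' t) (at t within {a..b})"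
  shows "((\<lambda>s. weighted_kernel a b w \<psi> l s t * g' s) has_integral
    (w b - w a) * (Phi \<psi> l * g t + (\<psi> l * g a + (1 - \<psi> (1 - l)) * g b) / 2)
      - integral {a..b} (\<lambda>s. \<nu> s * g s)) {a..b}"
proof -
  define c where "c = w a + \<psi> l * ((w b - w a) / 2)"
  define d where "d = w a + (1 + \<psi> (1 - l)) * ((w b - w a) / 2)"
  have sub: "{a..t} \<subseteq> {a..b}" "{t..b} \<subseteq> {a..b}"
    using t by auto
  have left: "((\<lambda>s. (w s - c) * g' s) has_integral
      (w t - c) * g t - (w a - c) * g a - integral {a..t} (\<lambda>s. \<nu> s * g s)) {a..t}"
    using t by (intro has_integral_by_parts_shift continuous_on_subset[OF \<nu> sub(1)]
        DERIV_subset[OF w sub(1)] DERIV_subset[OF g sub(1)]) auto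
  have right: "((\<lambda>s. (w s - d) * g' s) has_integral
      (w b - d) * g b - (w t - d) * g t - integral {t..b} (\<lambda>s. \<nu> s * g s)) {t..b}"
    using t by (intro has_integral_by_parts_shift continuous_on_subset[OF \<nu> sub(2)]
        DERIV_subset[OF w sub(2)] DERIV_subset[OF g sub(2)]) auto
  have "continuous_on {a..b} g"
    using g DERIV_continuous_on by blast
  then have "(\<lambda>s. \<nu> s * g s) integrable_on {a..b}"
    using \<nu> by (intro integrable_continuous_real continuous_intros)
  then have int: "integral {a..t} (\<lambda>s. \<nu> s * g s) + integral {t..b} (\<lambda>s. \<nu> s * g s)
      = integral {a..b} (\<lambda>s. \<nu> s * g s)"
    using t by (intro Henstock_Kurzweil_Integration.integral_combine) auto
  have kernel: "weighted_kernel a b w \<psi> l s t * g' s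
      = (if s < t then (w s - c) * g' s else (w s - d) * g' s)" for s
    by (simp add: weighted_kernel_def c_def d_def)
  \<comment> \<open>The coefficients come from \<open>d - c = (w b - w a) * Phi \<psi> l\<close> at
    \<open>t\<close>, \<open>c - w a = \<psi> l * (w b - w a) / 2\<close> at \<open>a\<close>, and
    \<open>w b - d = (1 - \<psi> (1 - l)) * (w b - w a) / 2\<close> at \<open>b\<close>.\<close>
  have boundary: "(w t - c) * g t - (w a - c) * g a - integral {a..t} (\<lambda>s. \<nu> s * g s)
      + ((w b - d) * g b - (w t - d) * g t - integral {t..b} (\<lambda>s. \<nu> s * g s))
    = (w b - w a) * (Phi \<psi> l * g t + (\<psi> l * g a + (1 - \<psi> (1 - l)) * g b) / 2)
      - integral {a..b} (\<lambda>s. \<nu> s * g s)"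
    unfolding int[symmetric] Phi_def c_def d_def
    by (simp add: algebra_simps diff_divide_distrib add_divide_distrib)
  show ?thesis
    using has_integral_if_less[OF _ _ left right] t unfolding kernel boundary by simp
qed

text \<open>Since \<open>M\<close> is a supremum over the open interval, it says nothing about
  \<open>h\<close> at the endpoints. Passing to \<open>{a<..<b}\<close> changes neither
  integral.\<close>

lemma abs_integral_mult_le:
  fixes k h :: "real \<Rightarrow> real"
  assumes kh: "(\<lambda>s. k s * h s) integrable_on {a..b}"
    and k: "(\<lambda>s. \<bar>k s\<bar>) integrable_on {a..b}"
    and M: "\<And>s. s \<in> {a<..<b} \<Longrightarrow> \<bar>h s\<bar> \<le> M"
  shows "\<bar>integral {a..b} (\<lambda>s. k s * h s)\<bar> \<le> M * integral {a..b} (\<lambda>s. \<bar>k s\<bar>)"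
proof -
  have "norm (integral {a<..<b} (\<lambda>s. k s * h s)) \<le> integral {a<..<b} (\<lambda>s. M * \<bar>k s\<bar>)"
  proof (rule integral_norm_bound_integral)
    show "(\<lambda>s. k s * h s) integrable_on {a<..<b}"
      using kh by (simp add: integrable_on_Icc_iff_Ioo)
    show "(\<lambda>s. M * \<bar>k s\<bar>) integrable_on {a<..<b}"
      using integrable_on_mult_right[OF k, of M] by (simp add: integrable_on_Icc_iff_Ioo)
    show "norm (k s * h s) \<le> M * \<bar>k s\<bar>" if "s \<in> {a<..<b}" for s
      using mult_right_mono[OF M[OF that], of "\<bar>k s\<bar>"] by (simp add: abs_mult mult.commute)
  qed
  then show ?thesis
    by (simp add: integral_open_interval_real)
qed

theorem corollary21:
  fixes a b M :: real and \<nu> w f f' f'' \<psi> :: "real \<Rightarrow> real"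
  assumes "a < b"
    and "continuous_on {a..b} \<nu>"
    and "\<And>t. t \<in> {a..b} \<Longrightarrow> \<nu> t > 0"
    and "\<And>t. t \<in> {a..b} \<Longrightarrow> (w has_real_derivative \<nu> t) (at t within {a..b})"
    and "\<And>t. t \<in> {a..b} \<Longrightarrow> (f has_real_derivative f' t) (at t within {a..b})"
    and "\<And>t. t \<in> {a..b} \<Longrightarrow> (f' has_real_derivative f'' t) (at t within {a..b})"
    and "\<psi> \<in> {0..1} \<rightarrow> {0..1}"
    and "bdd_above ((\<lambda>t. \<bar>f'' t\<bar>) ` {a<..<b})"
    and "M = (SUP t\<in>{a<..<b}. \<bar>f'' t\<bar>)"
  shows "\<forall>x\<in>{a..b}. \<forall>l\<in>{0..1}.
    \<bar>(Phi \<psi> l)\<^sup>2 * f x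
      - 1 / (integral {a..b} \<nu>)\<^sup>2
          * integral {a..b} (\<lambda>t. weighted_kernel a b w \<psi> l t x)
          * integral {a..b} (\<lambda>s. \<nu> s * f' s)
      + (\<psi> l * f' a + (1 - \<psi> (1 - l)) * f' b) / (2 * integral {a..b} \<nu>)
          * integral {a..b} (\<lambda>t. weighted_kernel a b w \<psi> l t x)
      - Phi \<psi> l / integral {a..b} \<nu> * integral {a..b} (\<lambda>t. \<nu> t * f t)
      + (\<psi> l * f a + (1 - \<psi> (1 - l)) * f b) / 2 * Phi \<psi> l\<bar>
    \<le> M / (integral {a..b} \<nu>)\<^sup>2
        * integral {a..b} (\<lambda>t. integral {a..b} (\<lambda>s.
            \<bar>weighted_kernel a b w \<psi> l t x\<bar> * \<bar>weighted_kernel a b w \<psi> l s t\<bar>))"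
proof (intro ballI)
  fix x l :: real
  assume x: "x \<in> {a..b}"
  let ?K = "weighted_kernel a b w \<psi> l"
  define m where "m = w b - w a"
  define A where "A t = integral {a..b} (\<lambda>s. \<bar>?K s t\<bar>)" for t
  define B where "B = (\<psi> l * f' a + (1 - \<psi> (1 - l)) * f' b) / 2"
  define N where "N = integral {a..b} (\<lambda>s. \<nu> s * f' s)"
  \<comment> \<open>\<open>H t\<close> is the value that the Montgomery identity for
    \<open>f'\<close> assigns to the integral of \<open>?K s t * f'' s\<close> over
    \<open>s\<close>. In this closed form it is visibly continuous and affine in
    \<open>f'\<close>.\<close>
  define H where "H t = m * (Phi \<psi> l * f' t + B) - N" for t
  have m: "integral {a..b} \<nu> = m"
    unfolding m_def using assms(1,4)
    by (intro integral_unique fundamental_theorem_of_calculus)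
      (auto simp flip: has_real_derivative_iff_has_vector_derivative)
  have "m > 0"
  proof -
    have "w a < w b"
    proof (rule DERIV_pos_imp_increasing_open[OF assms(1)])
      show "\<exists>y. (w has_real_derivative y) (at t) \<and> 0 < y" if "a < t" "t < b" for t
        using assms(3,4)[of t] that by (auto simp: at_within_Icc_at)
      show "continuous_on {a..b} w"
        using assms(4) DERIV_continuous_on by blast
    qed
    then show ?thesis by (simp add: m_def)
  qed
  have w: "continuous_on {a..b} w" and f': "continuous_on {a..b} f'"
    using assms(4,6) DERIV_continuous_on by blast+
  \<comment> \<open>The factor \<open>h\<close> will be \<open>f'\<close>, the constant 1 and
    \<open>H\<close>; in the version with absolute values below it will be 1 for the inner integral
    and \<open>A\<close> for the outer one.\<close>
  have K: "(\<lambda>s. ?K s t * h s) integrable_on {a..b}"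
    if "t \<in> {a..b}" "continuous_on {a..b} h" for t h
  proof -
    have eq: "?K s t * h s = (if s < t then (w s - (w a + \<psi> l * ((w b - w a) / 2))) * h s
      else (w s - (w a + (1 + \<psi> (1 - l)) * ((w b - w a) / 2))) * h s)" for s
      by (simp add: weighted_kernel_def)
    then show ?thesis
      unfolding eq using that w by (intro integrable_on_if_less continuous_intros)
  qed
  have absK_eq: "\<bar>?K s t\<bar> = (if s < t then \<bar>w s - (w a + \<psi> l * ((w b - w a) / 2))\<bar>
      else \<bar>w s - (w a + (1 + \<psi> (1 - l)) * ((w b - w a) / 2))\<bar>)" for s t
    by (simp add: weighted_kernel_def)
  have absK: "(\<lambda>s. \<bar>?K s t\<bar> * h s) integrable_on {a..b}"
    if "t \<in> {a..b}" "continuous_on {a..b} h" for t h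
  proof -
    have eq: "\<bar>?K s t\<bar> * h s = (if s < t then \<bar>w s - (w a + \<psi> l * ((w b - w a) / 2))\<bar> * h s
      else \<bar>w s - (w a + (1 + \<psi> (1 - l)) * ((w b - w a) / 2))\<bar> * h s)" for s
      by (simp add: weighted_kernel_def)
    then show ?thesis
      unfolding eq using that w by (intro integrable_on_if_less continuous_intros)
  qed
  have A: "continuous_on {a..b} A"
    unfolding A_def absK_eq using w
    by (intro continuous_on_integral_if_less continuous_intros)
  have H: "continuous_on {a..b} H"
    unfolding H_def using f' by (intro continuous_intros)
  have f'': "\<bar>f'' t\<bar> \<le> M" if "t \<in> {a<..<b}" for t
    unfolding assms(9) by (rule cSUP_upper[OF that assms(8)])
  have HA: "\<bar>H t\<bar> \<le> M * A t" if t: "t \<in> {a..b}" for t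
  proof -
    have "((\<lambda>s. ?K s t * f'' s) has_integral H t) {a..b}"
      using weighted_montgomery_identity[OF t assms(2,4,6), of \<psi> l]
      by (simp add: H_def B_def N_def m_def)
    moreover have "(\<lambda>s. \<bar>?K s t\<bar>) integrable_on {a..b}"
      using absK[OF t continuous_on_const[of _ 1]] by simp
    ultimately show ?thesis
      using abs_integral_mult_le[of "\<lambda>s. ?K s t" f'' a b M] f''
      unfolding A_def by (auto simp: has_integral_iff)
  qed
  define F where "F = integral {a..b} (\<lambda>t. ?K t x)"
  have outer: "integral {a..b} (\<lambda>t. ?K t x * f' t)
      = m * (Phi \<psi> l * f x + (\<psi> l * f a + (1 - \<psi> (1 - l)) * f b) / 2)
        - integral {a..b} (\<lambda>t. \<nu> t * f t)"
    using weighted_montgomery_identity[OF x assms(2,4,5), of \<psi> l]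
    by (simp add: m_def has_integral_iff)
  \<comment> \<open>Because \<open>H\<close> is affine in \<open>f'\<close>, only the integral of
    \<open>?K t x * f' t\<close>, given by \<open>outer\<close>, and the integral \<open>F\<close>
    of the kernel remain.\<close>
  have "integral {a..b} (\<lambda>t. ?K t x * H t)
      = integral {a..b} (\<lambda>t. m * Phi \<psi> l * (?K t x * f' t) + (m * B - N) * ?K t x)"
    by (rule integral_cong) (simp add: H_def algebra_simps)
  also have "\<dots> = m * Phi \<psi> l * integral {a..b} (\<lambda>t. ?K t x * f' t) + (m * B - N) * F"
    unfolding F_def using K[OF x f'] K[OF x continuous_on_const[of _ 1]]
    by (subst integral_add) (auto intro: integrable_on_mult_right)
  finally have KH: "integral {a..b} (\<lambda>t. ?K t x * H t)
      = m * Phi \<psi> l * integral {a..b} (\<lambda>t. ?K t x * f' t) + (m * B - N) * F" .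
  have "norm (integral {a..b} (\<lambda>t. ?K t x * H t)) \<le> integral {a..b} (\<lambda>t. M * (\<bar>?K t x\<bar> * A t))"
  proof (rule integral_norm_bound_integral)
    show "(\<lambda>t. M * (\<bar>?K t x\<bar> * A t)) integrable_on {a..b}"
      by (intro integrable_on_mult_right absK x A)
    show "norm (?K t x * H t) \<le> M * (\<bar>?K t x\<bar> * A t)" if "t \<in> {a..b}" for t
      using mult_left_mono[OF HA[OF that], of "\<bar>?K t x\<bar>"] by (simp add: abs_mult mult_ac)
  qed (rule K[OF x H])
  then have bound: "\<bar>integral {a..b} (\<lambda>t. ?K t x * H t) / m\<^sup>2\<bar>
      \<le> M / m\<^sup>2 * integral {a..b} (\<lambda>t. \<bar>?K t x\<bar> * A t)"
    using \<open>m > 0\<close> by (simp add: divide_right_mono)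
  \<comment> \<open>The algebra is done with plain variables: \<open>P\<close> for
    \<open>Phi \<psi> l\<close>, \<open>y\<close> for \<open>f x\<close>, \<open>V\<close> for the
    integral of \<open>\<nu> * f\<close>, and \<open>C\<close>, \<open>D\<close> for the endpoint
    combinations of \<open>f\<close> and \<open>f'\<close>.\<close>
  have cancel: "(m * P * (m * (P * y + C / 2) - V) + (m * (D / 2) - N) * F) / m\<^sup>2
      = P\<^sup>2 * y - 1 / m\<^sup>2 * F * N + D / (2 * m) * F - P / m * V + C / 2 * P"
    if "m \<noteq> 0" for P y C V D :: real
    using that by (simp add: field_simps power2_eq_square)
  have expand: "integral {a..b} (\<lambda>t. ?K t x * H t) / m\<^sup>2
      = (Phi \<psi> l)\<^sup>2 * f x - 1 / m\<^sup>2 * F * N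
        + (\<psi> l * f' a + (1 - \<psi> (1 - l)) * f' b) / (2 * m) * F
        - Phi \<psi> l / m * integral {a..b} (\<lambda>t. \<nu> t * f t)
        + (\<psi> l * f a + (1 - \<psi> (1 - l)) * f b) / 2 * Phi \<psi> l"
    unfolding KH outer B_def using \<open>m > 0\<close> by (intro cancel) simp
  show "\<bar>(Phi \<psi> l)\<^sup>2 * f x
      - 1 / (integral {a..b} \<nu>)\<^sup>2 * integral {a..b} (\<lambda>t. ?K t x)
          * integral {a..b} (\<lambda>s. \<nu> s * f' s)
      + (\<psi> l * f' a + (1 - \<psi> (1 - l)) * f' b) / (2 * integral {a..b} \<nu>)
          * integral {a..b} (\<lambda>t. ?K t x)
      - Phi \<psi> l / integral {a..b} \<nu> * integral {a..b} (\<lambda>t. \<nu> t * f t)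
      + (\<psi> l * f a + (1 - \<psi> (1 - l)) * f b) / 2 * Phi \<psi> l\<bar>
    \<le> M / (integral {a..b} \<nu>)\<^sup>2
        * integral {a..b} (\<lambda>t. integral {a..b} (\<lambda>s. \<bar>?K t x\<bar> * \<bar>?K s t\<bar>))"
    \<comment> \<open>The factor \<open>\<bar>?K t x\<bar>\<close> is constant in \<open>s\<close>
      and leaves the inner integral, which turns the double integral into that of
      \<open>\<bar>?K t x\<bar> * A t\<close>.\<close>
    using bound unfolding expand m F_def N_def A_def by (simp only: integral_mult_right)
qed

end
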